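(* Let $n\ge 2$. For every index pattern $\mathscr{I}$ of the complete graph $K_n$, the maturity weight of its sprout graph $\mathbb{K}_{n,\mathscr{I}}$ is $$mw(\mathbb{K}_{n,\mathscr{I}})=\sum_{j=1}^{n-1}\sum_{i=j}^{n-1}(n-i)=\sum_{j=1}^{n-1}\sum_{i=1}^{n-j} i .$$
   Context: An index pattern $\mathscr{I}$ of a graph on $n$ vertices is a bijective labelling of its vertices by $v_1,\dots,v_n$ (so the vertices carry the indices $1,\dots,n$). The sprout graph of a graph $G$ with respect to $\mathscr{I}$ is the directed graph on $V(G)$ obtained by replacing every edge $v_iv_j$ of $G$ with $i<j$ by the arc $(v_i,v_j)$. The weight of the arc $(v_i,v_j)$ is $j-i$, and the maturity weight $mw$ of a sprout graph is the sum of the weights of all its arcs. *)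

theory Defs
  imports "Graph_Theory.Kuratowski"
begin

text \<open>
  As in \<^theory>\<open>Graph_Theory.Digraph\<close>, an undirected edge is represented by the pair of its
  two opposite arcs, and \<^const>\<open>complete_digraph\<close> is the predicate characterising the
  complete graphs on a given number of vertices.

  An index pattern is given by the function sending each vertex to its index.
\<close>

definition index_pattern :: "('a, 'b) pre_digraph \<Rightarrow> ('a \<Rightarrow> nat) \<Rightarrow> bool" where
  "index_pattern G idx \<longleftrightarrow> bij_betw idx (verts G) {1..card (verts G)}"

text \<open>
  Of the two ordered pairs that represent an edge, the one with increasing index is kept.
\<close>

definition sprout_graph :: "('a, 'b) pre_digraph \<Rightarrow> ('a \<Rightarrow> nat) \<Rightarrow> 'a pair_pre_digraph" where
  "sprout_graph G idx =
     \<lparr> pverts = verts G, parcs = {(u, v). u \<rightarrow>\<^bsub>G\<^esub> v \<and> idx u < idx v} \<rparr>"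

definition arc_weight :: "('a \<Rightarrow> nat) \<Rightarrow> 'a \<times> 'a \<Rightarrow> int" where
  "arc_weight idx e = int (idx (snd e)) - int (idx (fst e))"

definition maturity_weight :: "'a pair_pre_digraph \<Rightarrow> ('a \<Rightarrow> nat) \<Rightarrow> int" where
  "maturity_weight S idx = (\<Sum>e\<in>parcs S. arc_weight idx e)"

end

theory Submission
  imports Defs
begin

text \<open>
  The pattern identifies the arcs with the pairs of indices \<open>p < q\<close>, so the maturity weight
  depends on \<open>n\<close> only. The arcs leaving the vertex of index \<open>j\<close> have the weights
  \<open>1, \<dots>, n - j\<close>.
\<close>

lemma bij_betw_sprout_arcs:
  assumes "complete_digraph n K" and "index_pattern K idx"
  shows "bij_betw (map_prod idx idx) (parcs (sprout_graph K idx))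
           (SIGMA p:{1..n - 1}. {p + 1..n})"
proof -
  have idx: "bij_betw idx (verts K) {1..n}"
    and ends: "arcs_ends K = {(u, v). (u, v) \<in> verts K \<times> verts K \<and> u \<noteq> v}"
    using assms by (auto simp: complete_digraph_def index_pattern_def)
  \<comment> \<open>Adjacency in \<open>K\<close> only asks for \<open>u \<noteq> v\<close>, which
    \<open>idx u < idx v\<close> already implies.\<close>
  have arcs: "parcs (sprout_graph K idx) = {(u, v) \<in> verts K \<times> verts K. idx u < idx v}"
    by (auto simp: sprout_graph_def ends)
  have "inj_on (map_prod idx idx) (verts K \<times> verts K)"
    using idx by (intro map_prod_inj_on) (auto simp: bij_betw_def)
  then have "inj_on (map_prod idx idx) (parcs (sprout_graph K idx))"
    by (rule inj_on_subset) (auto simp: arcs)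
  moreover have "map_prod idx idx ` parcs (sprout_graph K idx)
      = {(p, q) \<in> idx ` verts K \<times> idx ` verts K. p < q}"
    unfolding arcs by force
  \<comment> \<open>The first index stops at \<open>n - 1\<close>, since \<open>p < q\<close> and
    \<open>q \<le> n\<close>.\<close>
  moreover have "\<dots> = (SIGMA p:{1..n - 1}. {p + 1..n})"
    using idx by (auto simp: bij_betw_def)
  ultimately show ?thesis
    by (simp add: bij_betw_def)
qed

lemma maturity_weight_complete:
  assumes "complete_digraph n K" and "index_pattern K idx"
  shows "maturity_weight (sprout_graph K idx) idx = (\<Sum>j = 1..n - 1. \<Sum>i = 1..n - j. int i)"
proof -
  have "maturity_weight (sprout_graph K idx) idx
      = (\<Sum>(p, q)\<in>(SIGMA p:{1..n - 1}. {p + 1..n}). int q - int p)"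
    unfolding maturity_weight_def
    \<comment> \<open>The sum over index pairs is pulled back to the arcs, where its summand is
      \<open>arc_weight\<close>.\<close>
    by (subst sum.reindex_bij_betw[OF bij_betw_sprout_arcs[OF assms], symmetric])
      (simp add: arc_weight_def case_prod_beta)
  also have "\<dots> = (\<Sum>p = 1..n - 1. \<Sum>q = p + 1..n. int q - int p)"
    by (rule sum.Sigma[symmetric]) auto
  also have "\<dots> = (\<Sum>j = 1..n - 1. \<Sum>i = 1..n - j. int i)"
  proof (rule sum.cong[OF refl])
    fix j
    show "(\<Sum>q = j + 1..n. int q - int j) = (\<Sum>i = 1..n - j. int i)"
      \<comment> \<open>Here \<open>i = q - j\<close> is the weight of the arc from index
        \<open>j\<close> to index \<open>q\<close>.\<close>
      by (rule sum.reindex_bij_witness[where i = "\<lambda>i. i + j" and j = "\<lambda>q. q - j"]) auto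
  qed
  finally show ?thesis .
qed

text \<open>The reflection sending \<open>i\<close> to \<open>n - i\<close> is its own inverse and
  reverses the order of the terms. By \<open>1 \<le> j\<close>, every \<open>i\<close> on the left
  is below \<open>n\<close>, even for \<open>n = 0\<close>, so the truncated subtraction is
  exact.\<close>

lemma sum_reflect_int:
  fixes j n :: nat
  assumes "1 \<le> j"
  shows "(\<Sum>i = j..n - 1. int n - int i) = (\<Sum>i = 1..n - j. int i)"
  using assms
  by (intro sum.reindex_bij_witness[where i = "\<lambda>i. n - i" and j = "\<lambda>i. n - i"]) auto

theorem proposition4p1:
  fixes K :: "('a, 'b) pre_digraph" and idx :: "'a \<Rightarrow> nat" and n :: nat
  assumes "n \<ge> 2"
    and "complete_digraph n K"
    and "index_pattern K idx"
  shows "maturity_weight (sprout_graph K idx) idx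
           = (\<Sum>j = 1..n - 1. \<Sum>i = j..n - 1. int n - int i)
       \<and> (\<Sum>j = 1..n - 1. \<Sum>i = j..n - 1. int n - int i)
           = (\<Sum>j = 1..n - 1. \<Sum>i = 1..n - j. int i)"
proof -
  have "(\<Sum>j = 1..n - 1. \<Sum>i = j..n - 1. int n - int i) = (\<Sum>j = 1..n - 1. \<Sum>i = 1..n - j. int i)"
    \<comment> \<open>The inner sums agree for each \<open>j\<close> separately.\<close>
    by (intro sum.cong refl sum_reflect_int) simp
  with maturity_weight_complete[OF assms(2,3)] show ?thesis
    by simp
qed

end
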